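(* For $k\geq0$ let $(\mathfrak{S}\mathit{Sym})^k$ be the subspace of $\mathfrak{S}\mathit{Sym}$ spanned by $\{\mathcal{M}_u\mid u\in\mathfrak{S}^k\}$, where $\mathfrak{S}^0=\mathfrak{S}_0$ and, for $k\geq1$, $\mathfrak{S}^k$ is the set of permutations $u\in\mathfrak{S}_n$, $n\geq1$, having exactly $k-1$ global descents. Then the decomposition $\mathfrak{S}\mathit{Sym}=\bigoplus_{k\geq0}(\mathfrak{S}\mathit{Sym})^k$ is a coalgebra grading, and, endowed with this grading, $\mathfrak{S}\mathit{Sym}$ is a cofree graded coalgebra.
   Context: $\mathfrak{S}_n$ is the symmetric group on $[n]$ ($\mathfrak{S}_0$ has one element); $u$ is written as the word $u_1\cdots u_n$; permutations multiply as functions. $\ell(u)=\#\{i<j\mid u_i>u_j\}$; weak order: $u\leq v$ iff $v=wu$ with $\ell(v)=\ell(w)+\ell(u)$. A global descent of $u\in\mathfrak{S}_n$ is $p\in[n-1]$ with $u_i>u_j$ whenever $i\leq p<j$. For distinct integers $a_1,\dots,a_p$, $\mathrm{st}(a_1,\dots,a_p)\in\mathfrak{S}_p$ is the permutation $u$ with $u_i<u_j\iff a_i<a_j$; $u\times v\in\mathfrak{S}_{p+q}$ has word $u_1\cdots u_p(v_1+p)\cdots(v_q+p)$; $\mathfrak{S}^{(p,q)}$ is the set of $\zeta\in\mathfrak{S}_{p+q}$ with no descent except possibly at $p$. $\mathfrak{S}\mathit{Sym}$ is the graded $\mathbb{Q}$-vector space with basis $\{\mathcal{F}_u\mid u\in\mathfrak{S}_n,n\geq0\}$,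 product $\mathcal{F}_u\cdot\mathcal{F}_v=\sum_{\zeta\in\mathfrak{S}^{(p,q)}}\mathcal{F}_{(u\times v)\zeta^{-1}}$, coproduct $\Delta(\mathcal{F}_u)=\sum_{p=0}^n\mathcal{F}_{\mathrm{st}(u_1,\dots,u_p)}\otimes\mathcal{F}_{\mathrm{st}(u_{p+1},\dots,u_n)}$ and counit $\epsilon(\mathcal{F}_u)=0$ for $n\geq1$, $\epsilon(\mathcal{F}_\emptyset)=1$ (a graded connected Hopf algebra). The monomial basis is $\mathcal{M}_u=\sum_{v\geq u}\mu_{\mathfrak{S}_n}(u,v)\mathcal{F}_v$, $\mu_{\mathfrak{S}_n}$ the Möbius function of the weak order. A decomposition $C=\bigoplus_{k\geq0}C^k$ of a coalgebra is a coalgebra grading if $\Delta(C^k)\subseteq\sum_{i+j=k}C^i\otimes C^j$ and $\epsilon(C^k)=0$ for $k\neq0$. For a vector space $V$, $Q(V)=\bigoplus_{k\geq0}V^{\otimes k}$ is the graded coalgebra with deconcatenation coproduct $\Delta(v_1\otimes\cdots\otimes v_k)=\sum_{i=0}^k(v_1\otimes\cdots\otimes v_i)\otimes(v_{i+1}\otimes\cdots\otimes v_k)$ and counit vanishing on $V^{\otimes k}$, $k\geq1$; a graded coalgebra is cofree if it is isomorphic as a graded coalgebra to $Q(V)$ for some $V$. *)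

theory Defs
  imports Complex_Main "HOL-Library.Poly_Mapping" "HOL-Combinatorics.Permutations"
begin

section \<open>Free rational vector spaces and their tensor products\<close>

text \<open>
  The rational vector space with basis \<open>'a\<close> is the type \<open>'a \<Rightarrow>\<^sub>0 rat\<close> of finitely supported
  functions, the basis vector at \<open>a\<close> being \<open>basis a\<close>. The tensor product of the spaces with bases
  \<open>'a\<close> and \<open>'b\<close> is the space with basis \<open>'a \<times> 'b\<close>.
\<close>

abbreviation coef :: "('a \<Rightarrow>\<^sub>0 rat) \<Rightarrow> 'a \<Rightarrow> rat" where
  "coef \<equiv> Poly_Mapping.lookup"

abbreviation supp :: "('a \<Rightarrow>\<^sub>0 rat) \<Rightarrow> 'a set" where
  "supp \<equiv> Poly_Mapping.keys"

definition scl :: "rat \<Rightarrow> ('a \<Rightarrow>\<^sub>0 rat) \<Rightarrow> ('a \<Rightarrow>\<^sub>0 rat)" where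
  "scl c x = Poly_Mapping.map ((*) c) x"

lemma lookup_scl [simp]: "coef (scl c x) a = c * coef x a"
  by (simp add: scl_def map.rep_eq when_def)

global_interpretation fvs: vector_space scl
  by unfold_locales (auto intro!: poly_mapping_eqI simp: lookup_add algebra_simps)

definition basis :: "'a \<Rightarrow> ('a \<Rightarrow>\<^sub>0 rat)" where
  "basis a = Poly_Mapping.single a 1"

definition lin_ext :: "('a \<Rightarrow> ('b \<Rightarrow>\<^sub>0 rat)) \<Rightarrow> ('a \<Rightarrow>\<^sub>0 rat) \<Rightarrow> ('b \<Rightarrow>\<^sub>0 rat)" where
  "lin_ext f x = (\<Sum>a\<in>supp x. scl (coef x a) (f a))"

definition tensor :: "('a \<Rightarrow>\<^sub>0 rat) \<Rightarrow> ('b \<Rightarrow>\<^sub>0 rat) \<Rightarrow> ('a \<times> 'b \<Rightarrow>\<^sub>0 rat)" where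
  "tensor x y =
     (\<Sum>a\<in>supp x. \<Sum>b\<in>supp y. scl (coef x a * coef y b) (basis (a, b)))"

definition tensor_set ::
  "('a \<Rightarrow>\<^sub>0 rat) set \<Rightarrow> ('b \<Rightarrow>\<^sub>0 rat) set \<Rightarrow> ('a \<times> 'b \<Rightarrow>\<^sub>0 rat) set" where
  "tensor_set A B = fvs.span {tensor x y | x y. x \<in> A \<and> y \<in> B}"

definition tensor_map ::
  "(('a \<Rightarrow>\<^sub>0 rat) \<Rightarrow> ('c \<Rightarrow>\<^sub>0 rat)) \<Rightarrow> (('b \<Rightarrow>\<^sub>0 rat) \<Rightarrow> ('d \<Rightarrow>\<^sub>0 rat)) \<Rightarrow>
   ('a \<times> 'b \<Rightarrow>\<^sub>0 rat) \<Rightarrow> ('c \<times> 'd \<Rightarrow>\<^sub>0 rat)" where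
  "tensor_map f g = lin_ext (\<lambda>(a, b). tensor (f (basis a)) (g (basis b)))"

lemma lookup_basis: "coef (basis a) b = (if a = b then 1 else 0)"
  by (simp add: basis_def lookup_single when_def)

lemma lookup_lin_ext: "coef (lin_ext f x) b = (\<Sum>a\<in>supp x. coef x a * coef (f a) b)"
  by (simp add: lin_ext_def lookup_sum)

lemma lookup_tensor: "coef (tensor x y) (a, b) = coef x a * coef y b"
proof -
  have "coef (tensor x y) (a, b) =
      (\<Sum>a'\<in>supp x. \<Sum>b'\<in>supp y. if a' = a \<and> b' = b then coef x a * coef y b else 0)"
    unfolding tensor_def lookup_sum lookup_scl lookup_basis
    by (intro sum.cong refl) auto
  also have "\<dots> = (\<Sum>a'\<in>supp x. if a' = a then (if b \<in> supp y then coef x a * coef y b else 0) else 0)"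
    by (intro sum.cong refl) (auto simp: sum.delta)
  also have "\<dots> = coef x a * coef y b"
    by (simp add: sum.delta in_keys_iff)
  finally show ?thesis .
qed


section \<open>Gradings and cofreeness\<close>

definition direct_sum_decomposition :: "(nat \<Rightarrow> ('a \<Rightarrow>\<^sub>0 rat) set) \<Rightarrow> bool" where
  "direct_sum_decomposition C \<longleftrightarrow>
     (\<forall>k. fvs.subspace (C k)) \<and>
     (\<forall>x. \<exists>!g. (\<forall>k. g k \<in> C k) \<and> finite {k. g k \<noteq> 0} \<and> x = (\<Sum>k | g k \<noteq> 0. g k))"

definition coalgebra_grading ::
  "(('a \<Rightarrow>\<^sub>0 rat) \<Rightarrow> ('a \<times> 'a \<Rightarrow>\<^sub>0 rat)) \<Rightarrow> (('a \<Rightarrow>\<^sub>0 rat) \<Rightarrow> rat) \<Rightarrow>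
   (nat \<Rightarrow> ('a \<Rightarrow>\<^sub>0 rat) set) \<Rightarrow> bool" where
  "coalgebra_grading \<Delta> \<epsilon> C \<longleftrightarrow>
     direct_sum_decomposition C \<and>
     (\<forall>k. \<Delta> ` C k \<subseteq> fvs.span (\<Union>(i, j)\<in>{(i, j). i + j = k}. tensor_set (C i) (C j))) \<and>
     (\<forall>k. k \<noteq> 0 \<longrightarrow> \<epsilon> ` C k \<subseteq> {0})"

text \<open>
  Up to isomorphism, a rational vector space is a subspace \<open>V\<close> of some free space
  \<open>'b \<Rightarrow>\<^sub>0 rat\<close>. Over a field the tensor powers of \<open>V\<close> embed into those of \<open>'b \<Rightarrow>\<^sub>0 rat\<close>, and
  the \<open>k\<close>-th tensor power of the latter has the words of length \<open>k\<close> over \<open>'b\<close> as a basis. Hence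
  \<open>Q(V)\<close> is realized inside \<open>'b list \<Rightarrow>\<^sub>0 rat\<close>; \<open>pure_tensor [v\<^sub>1, \<dots>, v\<^sub>k]\<close> is
  \<open>v\<^sub>1 \<otimes> \<cdots> \<otimes> v\<^sub>k\<close>.
\<close>

fun pure_tensor :: "('b \<Rightarrow>\<^sub>0 rat) list \<Rightarrow> ('b list \<Rightarrow>\<^sub>0 rat)" where
  "pure_tensor [] = basis []"
| "pure_tensor (v # vs) = lin_ext (\<lambda>(b, w). basis (b # w)) (tensor v (pure_tensor vs))"

definition tensor_power :: "('b \<Rightarrow>\<^sub>0 rat) set \<Rightarrow> nat \<Rightarrow> ('b list \<Rightarrow>\<^sub>0 rat) set" where
  "tensor_power V k = fvs.span {pure_tensor vs | vs. length vs = k \<and> set vs \<subseteq> V}"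

definition Q_carrier :: "('b \<Rightarrow>\<^sub>0 rat) set \<Rightarrow> ('b list \<Rightarrow>\<^sub>0 rat) set" where
  "Q_carrier V = fvs.span (\<Union>k. tensor_power V k)"

text \<open>
  Deconcatenation is given on words; the lemma \<open>deconcatenation_pure_tensor\<close> below is the formula
  on arbitrary pure tensors.
\<close>

definition deconcatenation :: "('b list \<Rightarrow>\<^sub>0 rat) \<Rightarrow> ('b list \<times> 'b list \<Rightarrow>\<^sub>0 rat)" where
  "deconcatenation = lin_ext (\<lambda>w. \<Sum>i=0..length w. tensor (basis (take i w)) (basis (drop i w)))"

lemma lookup_pure_tensor_Cons:
  "coef (pure_tensor (v # vs)) [] = 0"
  "coef (pure_tensor (v # vs)) (b # w) = coef v b * coef (pure_tensor vs) w"
proof -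
  let ?t = "tensor v (pure_tensor vs)"
  show "coef (pure_tensor (v # vs)) [] = 0"
    by (auto simp: lookup_lin_ext lookup_basis intro!: sum.neutral)
  have "coef (pure_tensor (v # vs)) (b # w) =
      (\<Sum>p\<in>supp ?t. if p = (b, w) then coef ?t (b, w) else 0)"
    unfolding pure_tensor.simps lookup_lin_ext
    by (intro sum.cong refl) (auto simp: lookup_basis split: if_splits)
  also have "\<dots> = coef ?t (b, w)"
    by (simp add: sum.delta in_keys_iff)
  finally show "coef (pure_tensor (v # vs)) (b # w) = coef v b * coef (pure_tensor vs) w"
    by (simp add: lookup_tensor)
qed

lemma lookup_pure_tensor_length: "length w \<noteq> length vs \<Longrightarrow> coef (pure_tensor vs) w = 0"
proof (induction vs arbitrary: w)
  case Nil
  then show ?case by (auto simp: lookup_basis)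
next
  case (Cons v vs)
  then show ?case by (cases w) (simp_all only: lookup_pure_tensor_Cons, auto)
qed

lemma lookup_pure_tensor_append:
  "length w \<le> length vs \<Longrightarrow> coef (pure_tensor vs) (w @ w') =
     coef (pure_tensor (take (length w) vs)) w * coef (pure_tensor (drop (length w) vs)) w'"
proof (induction vs arbitrary: w)
  case Nil
  then show ?case by (simp add: lookup_basis)
next
  case (Cons v vs)
  show ?case
  proof (cases w)
    case Nil
    then show ?thesis by (simp add: lookup_basis del: pure_tensor.simps(2))
  next
    case (Cons b u)
    then show ?thesis
      using Cons.IH[of u] Cons.prems
      by (simp add: lookup_pure_tensor_Cons del: pure_tensor.simps(2))
  qed
qed

lemma lookup_deconcatenation: "coef (deconcatenation x) (w, w') = coef x (w @ w')"
proof -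
  have split: "(\<Sum>i=0..length u. coef (tensor (basis (take i u)) (basis (drop i u))) (w, w'))
      = (if u = w @ w' then 1 else 0)" for u :: "'a list"
  proof -
    have "(\<Sum>i=0..length u. coef (tensor (basis (take i u)) (basis (drop i u))) (w, w'))
      = (\<Sum>i=0..length u. if i = length w then (if u = w @ w' then 1 else 0) else 0)"
    proof (intro sum.cong refl)
      fix i assume i: "i \<in> {0..length u}"
      have iff: "take i u = w \<and> drop i u = w' \<longleftrightarrow> i = length w \<and> u = w @ w'"
        using i by (metis append_eq_conv_conj append_take_drop_id atLeastAtMost_iff length_take min.absorb2)
      have "coef (tensor (basis (take i u)) (basis (drop i u))) (w, w') =
          (if take i u = w \<and> drop i u = w' then 1 else 0)"
        by (auto simp: lookup_tensor lookup_basis)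
      then show "coef (tensor (basis (take i u)) (basis (drop i u))) (w, w') =
          (if i = length w then (if u = w @ w' then 1 else 0) else 0)"
        unfolding iff by (simp split: if_splits)
    qed
    also have "\<dots> = (if u = w @ w' then 1 else 0)"
      by (auto simp: sum.delta)
    finally show ?thesis .
  qed
  have "coef (deconcatenation x) (w, w') = (\<Sum>u\<in>supp x. coef x u * (if u = w @ w' then 1 else 0))"
    unfolding deconcatenation_def lookup_lin_ext lookup_sum split ..
  also have "\<dots> = (\<Sum>u\<in>supp x. if u = w @ w' then coef x (w @ w') else 0)"
    by (intro sum.cong refl) auto
  also have "\<dots> = coef x (w @ w')"
    by (simp add: sum.delta in_keys_iff)
  finally show ?thesis .
qed

lemma deconcatenation_pure_tensor:
  "deconcatenation (pure_tensor vs) =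
     (\<Sum>i=0..length vs. tensor (pure_tensor (take i vs)) (pure_tensor (drop i vs)))"
proof (rule poly_mapping_eqI)
  fix p :: "'a list \<times> 'a list"
  obtain w w' where p: "p = (w, w')" by (cases p)
  have "(\<Sum>i=0..length vs. coef (pure_tensor (take i vs)) w * coef (pure_tensor (drop i vs)) w')
     = (\<Sum>i=0..length vs. if i = length w then coef (pure_tensor vs) (w @ w') else 0)"
  proof (intro sum.cong refl)
    fix i assume i: "i \<in> {0..length vs}"
    show "coef (pure_tensor (take i vs)) w * coef (pure_tensor (drop i vs)) w' =
        (if i = length w then coef (pure_tensor vs) (w @ w') else 0)"
    proof (cases "i = length w")
      case True
      then show ?thesis using i lookup_pure_tensor_append[of w vs w'] by simp
    next
      case False
      then show ?thesis using i lookup_pure_tensor_length[of w "take i vs"] by simp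
    qed
  qed
  also have "\<dots> = coef (pure_tensor vs) (w @ w')"
    using lookup_pure_tensor_length[of "w @ w'" vs] by (auto simp: sum.delta)
  finally show "coef (deconcatenation (pure_tensor vs)) p =
      coef (\<Sum>i=0..length vs. tensor (pure_tensor (take i vs)) (pure_tensor (drop i vs))) p"
    by (simp add: p lookup_deconcatenation lookup_sum lookup_tensor)
qed

definition Q_counit :: "('b list \<Rightarrow>\<^sub>0 rat) \<Rightarrow> rat" where
  "Q_counit x = coef x []"

text \<open>
  The coalgebra has the full space \<open>'a \<Rightarrow>\<^sub>0 rat\<close> as its carrier. Taking \<open>V\<close> to be a subspace of the
  same space is no restriction: an isomorphism of graded coalgebras with \<open>Q(V)\<close> forces
  \<open>V \<cong> C 1\<close>.
\<close>

definition cofree_graded_coalgebra ::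
  "(('a \<Rightarrow>\<^sub>0 rat) \<Rightarrow> ('a \<times> 'a \<Rightarrow>\<^sub>0 rat)) \<Rightarrow> (('a \<Rightarrow>\<^sub>0 rat) \<Rightarrow> rat) \<Rightarrow>
   (nat \<Rightarrow> ('a \<Rightarrow>\<^sub>0 rat) set) \<Rightarrow> bool" where
  "cofree_graded_coalgebra \<Delta> \<epsilon> C \<longleftrightarrow>
     coalgebra_grading \<Delta> \<epsilon> C \<and>
     (\<exists>(V :: ('a \<Rightarrow>\<^sub>0 rat) set) (f :: ('a \<Rightarrow>\<^sub>0 rat) \<Rightarrow> ('a list \<Rightarrow>\<^sub>0 rat)).
        fvs.subspace V \<and>
        Vector_Spaces.linear scl scl f \<and>
        bij_betw f UNIV (Q_carrier V) \<and>
        (\<forall>k. f ` C k = tensor_power V k) \<and>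
        (\<forall>x. deconcatenation (f x) = tensor_map f f (\<Delta> x)) \<and>
        (\<forall>x. Q_counit (f x) = \<epsilon> x))"


section \<open>Permutations and the weak order\<close>

text \<open>
  The disjoint union of all symmetric groups: the size is recorded, so that the identities of the
  different groups are distinct.
\<close>

typedef fin_perm = "{(n :: nat, u :: nat \<Rightarrow> nat). u permutes {1..n}}"
  morphisms rep_fin_perm abs_fin_perm
  by (rule exI[of _ "(0, id)"]) (simp add: permutes_id)

definition sz :: "fin_perm \<Rightarrow> nat" where
  "sz u = fst (rep_fin_perm u)"

definition ap :: "fin_perm \<Rightarrow> nat \<Rightarrow> nat" where
  "ap u = snd (rep_fin_perm u)"

definition word :: "fin_perm \<Rightarrow> nat list" where
  "word u = map (ap u) [1..<Suc (sz u)]"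

definition inversions :: "fin_perm \<Rightarrow> (nat \<times> nat) set" where
  "inversions u = {(i, j). 1 \<le> i \<and> i < j \<and> j \<le> sz u \<and> ap u i > ap u j}"

definition len :: "fin_perm \<Rightarrow> nat" where
  "len u = card (inversions u)"

definition weak_le :: "fin_perm \<Rightarrow> fin_perm \<Rightarrow> bool" where
  "weak_le u v \<longleftrightarrow>
     sz u = sz v \<and> (\<exists>w. sz w = sz u \<and> ap v = ap w \<circ> ap u \<and> len v = len w + len u)"

definition global_descents :: "fin_perm \<Rightarrow> nat set" where
  "global_descents u =
     {p \<in> {1..sz u - 1}. \<forall>i j. 1 \<le> i \<and> i \<le> p \<and> p < j \<and> j \<le> sz u \<longrightarrow> ap u i > ap u j}"

text \<open>Only meant for lists of distinct numbers; positions in words start at 1, in lists at 0.\<close>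

definition st :: "nat list \<Rightarrow> fin_perm" where
  "st a = (THE u. sz u = length a \<and>
     (\<forall>i j. 1 \<le> i \<and> i \<le> length a \<and> 1 \<le> j \<and> j \<le> length a \<longrightarrow>
        (ap u i < ap u j \<longleftrightarrow> a ! (i - 1) < a ! (j - 1))))"

lemma ap_permutes: "ap u permutes {1..sz u}"
  using rep_fin_perm[of u] by (auto simp: ap_def sz_def)

lemma fin_perm_eqI: "sz u = sz v \<Longrightarrow> ap u = ap v \<Longrightarrow> u = v"
  by (metis ap_def sz_def prod.collapse rep_fin_perm_inject)

lemma finite_inversions: "finite (inversions u)"
  by (rule finite_subset[of _ "{1..sz u} \<times> {1..sz u}"]) (auto simp: inversions_def)

lemma finite_fin_perm_sz: "finite {u. sz u = n}"
proof -
  have "finite ({f. f permutes {1..n}})" by (rule finite_permutations) simp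
  moreover have "ap ` {u. sz u = n} \<subseteq> {f. f permutes {1..n}}"
    using ap_permutes by auto
  moreover have "inj_on ap {u. sz u = n}"
    by (auto intro!: inj_onI fin_perm_eqI)
  ultimately show ?thesis by (meson finite_imageD finite_subset)
qed

lemma len_0_imp_id:
  assumes "len w = 0"
  shows "ap w = id"
proof -
  have noinv: "ap w i \<le> ap w j" if "1 \<le> i" "i < j" "j \<le> sz w" for i j
  proof -
    have "inversions w = {}" using assms finite_inversions[of w] by (simp add: len_def)
    then have "(i, j) \<notin> inversions w" by simp
    with that show ?thesis by (simp add: inversions_def)
  qed
  have p: "ap w permutes {1..sz w}" by (rule ap_permutes)
  have smono: "ap w i < ap w j" if "1 \<le> i" "i < j" "j \<le> sz w" for i j
    using noinv[OF that] permutes_inj[OF p] that(2) by (metis injD le_neq_implies_less less_not_refl)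
  have ge: "i \<le> ap w i" if "i \<in> {1..sz w}" for i
    using that
  proof (induction i)
    case (Suc i)
    show ?case
    proof (cases "i = 0")
      case True
      have "ap w (Suc i) \<in> {1..sz w}" using permutes_in_image[OF p] Suc.prems by blast
      then show ?thesis using True by simp
    next
      case False
      then have "i \<le> ap w i" "ap w i < ap w (Suc i)" using Suc smono by auto
      then show ?thesis by simp
    qed
  qed simp
  have "ap w i = i" for i
  proof (rule ccontr)
    assume neq: "ap w i \<noteq> i"
    then have i: "i \<in> {1..sz w}" using p by (meson permutes_not_in)
    have "(\<Sum>k\<in>{1..sz w}. k) < (\<Sum>k\<in>{1..sz w}. ap w k)"
      by (rule sum_strict_mono_ex1) (use ge i neq in \<open>auto intro!: bexI[of _ i] simp: le_neq_implies_less\<close>)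
    also have "\<dots> = (\<Sum>k\<in>{1..sz w}. k)"
      using sum.permute[OF p, of "\<lambda>k. k"] by (simp add: o_def)
    finally show False by simp
  qed
  then show ?thesis by auto
qed

lemma weak_le_imp_len_less:
  assumes "weak_le u v" and "u \<noteq> v"
  shows "len u < len v"
proof -
  from assms obtain w where w: "sz u = sz v" "sz w = sz u" "ap v = ap w \<circ> ap u" "len v = len w + len u"
    by (auto simp: weak_le_def)
  have "len w \<noteq> 0"
  proof
    assume "len w = 0"
    then have "u = v" using w len_0_imp_id[of w] by (intro fin_perm_eqI) auto
    with assms show False by simp
  qed
  with w show ?thesis by simp
qed

text \<open>
  The Moebius function of the weak order, by the usual recursion over intervals. All the symmetric
  groups are treated at once: permutations of different sizes are incomparable.
\<close>

function mobius :: "fin_perm \<Rightarrow> fin_perm \<Rightarrow> int" where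
  "mobius u v =
     (if u = v then 1
      else if weak_le u v then - (\<Sum>z\<in>{z. weak_le u z \<and> weak_le z v \<and> z \<noteq> v}. mobius u z)
      else 0)"
  by auto
termination
  by (relation "measure (\<lambda>(u, v). len v)") (auto intro: weak_le_imp_len_less)

declare mobius.simps [simp del]


section \<open>The coalgebra of permutations\<close>

type_synonym ssym = "fin_perm \<Rightarrow>\<^sub>0 rat"

abbreviation Fund :: "fin_perm \<Rightarrow> ssym" (\<open>\<F>\<close>) where
  "\<F> u \<equiv> basis u"

definition ssym_coproduct :: "ssym \<Rightarrow> (fin_perm \<times> fin_perm \<Rightarrow>\<^sub>0 rat)" where
  "ssym_coproduct =
     lin_ext (\<lambda>u. \<Sum>p=0..sz u. tensor (\<F> (st (take p (word u)))) (\<F> (st (drop p (word u)))))"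

definition ssym_counit :: "ssym \<Rightarrow> rat" where
  "ssym_counit x = (\<Sum>u\<in>supp x. coef x u * (if sz u = 0 then 1 else 0))"

definition Monom :: "fin_perm \<Rightarrow> ssym" (\<open>\<M>\<close>) where
  "\<M> u = (\<Sum>v | weak_le u v. scl (of_int (mobius u v)) (\<F> v))"

definition perm_grade :: "nat \<Rightarrow> fin_perm set" where
  "perm_grade k =
     (if k = 0 then {u. sz u = 0} else {u. sz u \<ge> 1 \<and> card (global_descents u) = k - 1})"

definition ssym_grade :: "nat \<Rightarrow> ssym set" where
  "ssym_grade k = fvs.span (\<M> ` perm_grade k)"

end

theory Submission
  imports Defs
begin

text \<open>
  By Moebius inversion \<open>\<F> u\<close> is the sum of all \<open>\<M> v\<close> with \<open>v \<ge> u\<close>. Writing \<open>a \ b\<close> for the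
  permutation whose word is that of \<open>a\<close>, shifted above \<open>b\<close>, followed by that of \<open>b\<close>, every permutation
  is in a unique way such a product of nonempty permutations without global descents, the number of
  factors being its degree. Since the weak order is containment of inversion sets, \<open>u \<le> a \ b\<close> iff
  the standardizations of the first \<open>|a|\<close> and of the last \<open>|b|\<close> letters of \<open>u\<close> are below
  \<open>a\<close> and \<open>b\<close>. Comparing coefficients, this says that sending \<open>\<M> u\<close> to the word of factors of \<open>u\<close>
  turns the coproduct into deconcatenation, which gives both claims.
\<close>


section \<open>Linear extensions and tensors\<close>

lemma lin_ext_superset:
  assumes "finite A" "supp x \<subseteq> A"
  shows "lin_ext f x = (\<Sum>a\<in>A. scl (coef x a) (f a))"
  unfolding lin_ext_def by (rule sum.mono_neutral_left) (use assms in \<open>auto simp: in_keys_iff\<close>)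

lemma linear_lin_ext: "Vector_Spaces.linear scl scl (lin_ext f)"
proof unfold_locales
  show "lin_ext f (x + y) = lin_ext f x + lin_ext f y" for x y
    using lin_ext_superset[of "supp x \<union> supp y" "x + y" f]
      lin_ext_superset[of "supp x \<union> supp y" x f] lin_ext_superset[of "supp x \<union> supp y" y f]
      Poly_Mapping.keys_add[of x y]
    by (simp add: lookup_add fvs.scale_left_distrib sum.distrib)
  show "lin_ext f (scl c x) = scl c (lin_ext f x)" for c x
  proof -
    have "supp (scl c x) \<subseteq> supp x" by (auto simp: in_keys_iff)
    from lin_ext_superset[OF _ this, of f] show ?thesis
      by (simp add: lin_ext_def[of f x] fvs.scale_sum_right)
  qed
qed

lemma supp_basis [simp]: "supp (basis a) = {a}"
  by (simp add: basis_def)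

lemma lin_ext_basis [simp]: "lin_ext f (basis a) = f a"
  by (simp add: lin_ext_def lookup_basis)

lemma sum_coef_basis: "(\<Sum>a\<in>supp x. scl (coef x a) (basis a)) = x"
  by (rule poly_mapping_eqI)
    (simp add: lookup_sum lookup_basis in_keys_iff if_distrib[of "(*) _"] cong: if_cong)

lemma linear_eq_lin_ext:
  assumes "Vector_Spaces.linear scl scl f"
  shows "lin_ext (\<lambda>a. f (basis a)) x = f x"
proof -
  interpret f: Vector_Spaces.linear scl scl f by fact
  have "f (\<Sum>a\<in>supp x. scl (coef x a) (basis a)) = lin_ext (\<lambda>a. f (basis a)) x"
    by (simp add: f.sum f.scale lin_ext_def)
  then show ?thesis by (simp add: sum_coef_basis)
qed

lemma linear_eqI:
  assumes "Vector_Spaces.linear scl scl f" "Vector_Spaces.linear scl scl g"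
    and "\<And>a. f (basis a) = g (basis a)"
  shows "f x = g x"
proof -
  have "lin_ext (\<lambda>a. f (basis a)) x = lin_ext (\<lambda>a. g (basis a)) x"
    by (simp add: assms(3))
  then show ?thesis by (simp only: linear_eq_lin_ext assms(1,2))
qed

lemma linear_compose_apply:
  assumes "Vector_Spaces.linear scl scl f" "Vector_Spaces.linear scl scl g"
  shows "Vector_Spaces.linear scl scl (\<lambda>x. g (f x))"
  using Vector_Spaces.linear_compose[OF assms] by (simp add: o_def)

text \<open>Turns membership in such a span into a condition on supports, the form used for the
  subspaces below.\<close>

lemma span_basis: "fvs.span (basis ` A) = {x. supp x \<subseteq> A}"
proof
  have "fvs.subspace {x. supp x \<subseteq> A}"
  proof (rule fvs.subspaceI; unfold mem_Collect_eq)
    show "supp (x + y) \<subseteq> A" if "supp x \<subseteq> A" "supp y \<subseteq> A" for x y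
      using Poly_Mapping.keys_add[of x y] that by blast
    show "supp (scl c x) \<subseteq> A" if "supp x \<subseteq> A" for c x
      using that by (auto simp: in_keys_iff)
  qed simp
  then show "fvs.span (basis ` A) \<subseteq> {x. supp x \<subseteq> A}"
    by (intro fvs.span_minimal) auto
  show "{x. supp x \<subseteq> A} \<subseteq> fvs.span (basis ` A)"
  proof clarify
    fix x assume "supp x \<subseteq> A"
    then have "(\<Sum>a\<in>supp x. scl (coef x a) (basis a)) \<in> fvs.span (basis ` A)"
      by (intro fvs.span_sum fvs.span_scale fvs.span_base) auto
    then show "x \<in> fvs.span (basis ` A)" by (simp add: sum_coef_basis)
  qed
qed

lemma linear_tensor_map: "Vector_Spaces.linear scl scl (tensor_map f g)"
  unfolding tensor_map_def by (rule linear_lin_ext)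

lemma tensor_basis: "tensor (basis a) (basis b) = basis (a, b)"
proof (rule poly_mapping_eqI)
  show "coef (tensor (basis a) (basis b)) p = coef (basis (a, b)) p" for p
    by (cases p) (simp add: lookup_tensor lookup_basis)
qed

text \<open>\<open>tensor_map\<close> is defined through basis pairs only; linearity of
  \<open>f\<close> and \<open>g\<close> expands both sides into the same double sum over the two
  supports.\<close>

lemma tensor_map_tensor:
  fixes f :: "('a \<Rightarrow>\<^sub>0 rat) \<Rightarrow> ('c \<Rightarrow>\<^sub>0 rat)" and g :: "('b \<Rightarrow>\<^sub>0 rat) \<Rightarrow> ('d \<Rightarrow>\<^sub>0 rat)"
  assumes "Vector_Spaces.linear scl scl f" "Vector_Spaces.linear scl scl g"
  shows "tensor_map f g (tensor x y) = tensor (f x) (g y)"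
proof (rule poly_mapping_eqI)
  fix p :: "'c \<times> 'd"
  obtain c d where p: "p = (c, d)" by (cases p)
  have sub: "supp (tensor x y) \<subseteq> supp x \<times> supp y"
    by (auto simp: in_keys_iff lookup_tensor)
  have "coef (tensor_map f g (tensor x y)) p =
    (\<Sum>a\<in>supp x. \<Sum>b\<in>supp y. (coef x a * coef (f (basis a)) c) * (coef y b * coef (g (basis b)) d))"
    unfolding tensor_map_def lin_ext_superset[OF _ sub, simplified] p
    by (auto simp: lookup_sum lookup_tensor sum.cartesian_product mult_ac intro!: sum.cong)
  also have "\<dots> = coef (lin_ext (\<lambda>a. f (basis a)) x) c * coef (lin_ext (\<lambda>b. g (basis b)) y) d"
    by (simp add: lookup_lin_ext sum_product)
  finally show "coef (tensor_map f g (tensor x y)) p = coef (tensor (f x) (g y)) p"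
    by (simp add: linear_eq_lin_ext assms p lookup_tensor)
qed

lemma tensor_map_basis: "tensor_map f g (basis (a, b)) = tensor (f (basis a)) (g (basis b))"
  by (simp add: tensor_map_def)

section \<open>Tensor powers of a space spanned by basis vectors\<close>

lemma pure_tensor_map_basis: "pure_tensor (map basis w) = basis w"
  by (induction w) (simp_all add: tensor_basis)

lemma pure_tensor_support:
  assumes "\<forall>v\<in>set vs. supp v \<subseteq> B" "w \<in> supp (pure_tensor vs)"
  shows "w \<in> lists B \<and> length w = length vs"
  using assms
proof (induction vs arbitrary: w)
  case (Cons v vs)
  obtain b w' where w: "w = b # w'"
    using Cons.prems(2) lookup_pure_tensor_Cons(1)[of v vs] by (cases w) (auto simp: in_keys_iff)
  then have "b \<in> supp v" "w' \<in> supp (pure_tensor vs)"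
    using Cons.prems(2) lookup_pure_tensor_Cons(2)[of v vs b w']
    by (auto simp: in_keys_iff simp del: pure_tensor.simps)
  moreover have "w' \<in> lists B \<and> length w' = length vs"
    by (rule Cons.IH) (use Cons.prems(1) \<open>w' \<in> supp (pure_tensor vs)\<close> in auto)
  ultimately show ?case using Cons.prems(1) w by auto
qed simp

text \<open>Pure tensors of basis vectors are single words, and conversely a pure tensor over such a
  space involves only words in \<open>B\<close> of the right length.\<close>

lemma tensor_power_span_basis:
  "tensor_power (fvs.span (basis ` B)) k = fvs.span (basis ` {w \<in> lists B. length w = k})"
proof (unfold tensor_power_def, rule fvs.span_eq[THEN iffD2], rule conjI)
  show "{pure_tensor vs |vs. length vs = k \<and> set vs \<subseteq> fvs.span (basis ` B)}
    \<subseteq> fvs.span (basis ` {w \<in> lists B. length w = k})"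
    unfolding span_basis using pure_tensor_support[of _ B] by blast
  show "basis ` {w \<in> lists B. length w = k}
    \<subseteq> fvs.span {pure_tensor vs |vs. length vs = k \<and> set vs \<subseteq> fvs.span (basis ` B)}"
  proof (rule image_subsetI, rule fvs.span_base)
    fix w assume "w \<in> {w \<in> lists B. length w = k}"
    then show "basis w \<in> {pure_tensor vs |vs. length vs = k \<and> set vs \<subseteq> fvs.span (basis ` B)}"
      by (auto simp: pure_tensor_map_basis intro!: exI[of _ "map basis w"] fvs.span_base)
  qed
qed

lemma Q_carrier_span_basis:
  "Q_carrier (fvs.span (basis ` B)) = fvs.span (basis ` lists B)"
proof -
  let ?S = "\<lambda>k. basis ` {w \<in> lists B. length w = k}"
  have "fvs.span (\<Union>k. fvs.span (?S k)) = fvs.span (\<Union>k. ?S k)"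
  proof (rule fvs.span_eq[THEN iffD2], rule conjI)
    show "(\<Union>k. fvs.span (?S k)) \<subseteq> fvs.span (\<Union>k. ?S k)"
      by (intro UN_least fvs.span_mono) blast
    show "(\<Union>k. ?S k) \<subseteq> fvs.span (\<Union>k. fvs.span (?S k))"
      by (rule UN_least, rule order_trans[OF fvs.span_superset], rule order_trans[OF _ fvs.span_superset])
        (rule UN_upper, rule UNIV_I)
  qed
  moreover have "(\<Union>k. ?S k) = basis ` lists B" by blast
  ultimately show ?thesis by (simp add: Q_carrier_def tensor_power_span_basis)
qed

lemma linear_deconcatenation: "Vector_Spaces.linear scl scl deconcatenation"
  unfolding deconcatenation_def by (rule linear_lin_ext)


section \<open>The weak order by inversion sets\<close>

lemma sz_ap_abs_fin_perm:
  assumes "f permutes {1..n}"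
  shows "sz (abs_fin_perm (n, f)) = n" and "ap (abs_fin_perm (n, f)) = f"
  using assms by (simp_all add: sz_def ap_def abs_fin_perm_inverse)

lemma ap_in_iff: "ap u i \<in> {1..sz u} \<longleftrightarrow> i \<in> {1..sz u}"
  using permutes_in_image[OF ap_permutes] .

lemma ap_eq_iff [simp]: "ap u i = ap u j \<longleftrightarrow> i = j"
  using permutes_inj[OF ap_permutes] by (auto simp: inj_def)

lemma ap_outside: "i \<notin> {1..sz u} \<Longrightarrow> ap u i = i"
  using ap_permutes permutes_not_in by metis

text \<open>The sum of the two cardinalities counts the common part twice, the symmetric difference
  not at all.\<close>

lemma card_sym_diff_eq_iff:
  assumes "finite A" "finite B"
  shows "card (sym_diff A B) = card A + card B \<longleftrightarrow> A \<inter> B = {}"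
proof -
  have "card (sym_diff A B) = card (A - B) + card (B - A)"
    by (rule card_Un_disjoint) (use assms in auto)
  moreover have "card A = card (A - B) + card (A \<inter> B)"
    using card_Int_Diff[OF assms(1), of B] by simp
  moreover have "card B = card (B - A) + card (A \<inter> B)"
    using card_Int_Diff[OF assms(2), of A] by (simp add: Int_commute)
  ultimately show ?thesis using assms by auto
qed

text \<open>
  A pair of positions is an inversion of \<open>w \<circ> u\<close> iff exactly one of the following holds: it is an
  inversion of \<open>u\<close>, or \<open>w\<close> inverts the two values of \<open>u\<close> there. So the lengths add up iff the
  two never happen together.
\<close>

lemma len_compose_eq_iff:
  assumes "sz w = sz u" "sz v = sz u" "ap v = ap w \<circ> ap u"
  shows "len v = len w + len u \<longleftrightarrow> inversions u \<subseteq> inversions v"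
proof -
  \<comment> \<open>Pairs of positions whose values under \<open>u\<close> are inverted by
    \<open>w\<close>; \<open>min\<close> and \<open>max\<close> list these values in increasing
    order, as inversions of \<open>w\<close> require.\<close>
  define N where "N = {(i, j). 1 \<le> i \<and> i < j \<and> j \<le> sz u \<and>
    (min (ap u i) (ap u j), max (ap u i) (ap u j)) \<in> inversions w}"
  have rng: "1 \<le> ap u i \<and> ap u i \<le> sz u \<longleftrightarrow> 1 \<le> i \<and> i \<le> sz u" for i
    using ap_in_iff[of u i] by simp
  have "finite N"
    by (rule finite_subset[of _ "{1..sz u} \<times> {1..sz u}"]) (auto simp: N_def)
  \<comment> \<open>Passing from positions to values matches \<open>N\<close> with the inversions of
    \<open>w\<close>.\<close>
  have "bij_betw (\<lambda>(i, j). (min (ap u i) (ap u j), max (ap u i) (ap u j))) N (inversions w)"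
  proof (rule bij_betw_imageI)
    show "inj_on (\<lambda>(i, j). (min (ap u i) (ap u j), max (ap u i) (ap u j))) N"
      by (auto simp: inj_on_def N_def min_def max_def split: if_splits)
    show "(\<lambda>(i, j). (min (ap u i) (ap u j), max (ap u i) (ap u j))) ` N = inversions w"
    proof
      show "(\<lambda>(i, j). (min (ap u i) (ap u j), max (ap u i) (ap u j))) ` N \<subseteq> inversions w"
        by (auto simp: N_def)
      show "inversions w \<subseteq> (\<lambda>(i, j). (min (ap u i) (ap u j), max (ap u i) (ap u j))) ` N"
      proof clarify
        fix a b assume ab: "(a, b) \<in> inversions w"
        obtain i j where ij: "ap u i = a" "ap u j = b"
          using permutes_surj[OF ap_permutes[of u]] by (metis surjD)
        have "a < b" "1 \<le> a" "b \<le> sz u" using ab assms(1) by (auto simp: inversions_def)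
        then have "(min i j, max i j) \<in> N"
          using ab ij rng[of i] rng[of j] by (cases i j rule: linorder_cases) (auto simp: N_def)
        moreover have "(\<lambda>(i, j). (min (ap u i) (ap u j), max (ap u i) (ap u j))) (min i j, max i j) = (a, b)"
          using ij \<open>a < b\<close> by (auto simp: min_def max_def)
        ultimately show "(a, b) \<in> (\<lambda>(i, j). (min (ap u i) (ap u j), max (ap u i) (ap u j))) ` N"
          by (rule rev_image_eqI[OF _ sym])
      qed
    qed
  qed
  then have card_N: "card N = len w"
    unfolding len_def by (rule bij_betw_same_card)
  have iff: "(i, j) \<in> inversions v \<longleftrightarrow> (i, j) \<in> sym_diff (inversions u) N" for i j
  proof (cases "1 \<le> i \<and> i < j \<and> j \<le> sz u")
    case True
    then have "ap w (ap u i) \<noteq> ap w (ap u j)" "ap u i \<noteq> ap u j" by auto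
    then show ?thesis
      using True rng[of i] rng[of j] assms
      by (cases "ap u i" "ap u j" rule: linorder_cases;
          cases "ap w (ap u i)" "ap w (ap u j)" rule: linorder_cases)
        (auto simp: inversions_def N_def)
  next
    case False
    then show ?thesis using assms by (auto simp: inversions_def N_def)
  qed
  have inv_v: "inversions v = sym_diff (inversions u) N"
    using iff by auto
  have "len v = len w + len u \<longleftrightarrow> card (sym_diff (inversions u) N) = card (inversions u) + card N"
    using card_N inv_v by (auto simp: len_def)
  also have "\<dots> \<longleftrightarrow> inversions u \<inter> N = {}"
    by (rule card_sym_diff_eq_iff) (auto simp: finite_inversions \<open>finite N\<close>)
  also have "\<dots> \<longleftrightarrow> inversions u \<subseteq> inversions v"
    unfolding inv_v by auto
  finally show ?thesis .
qed

text \<open>The factor \<open>w\<close> can only be \<open>v\<close> composed with the inverse of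
  \<open>u\<close>. What remains is the condition on lengths, which
  \<open>len_compose_eq_iff\<close> turns into containment.\<close>

lemma weak_le_iff: "weak_le u v \<longleftrightarrow> sz u = sz v \<and> inversions u \<subseteq> inversions v"
proof
  assume "weak_le u v"
  then show "sz u = sz v \<and> inversions u \<subseteq> inversions v"
    using len_compose_eq_iff by (auto simp: weak_le_def)
next
  assume R: "sz u = sz v \<and> inversions u \<subseteq> inversions v"
  define f where "f = ap v \<circ> inv (ap u)"
  have f: "f permutes {1..sz u}"
    unfolding f_def using R ap_permutes[of u] ap_permutes[of v]
    by (auto intro: permutes_compose permutes_inv)
  let ?w = "abs_fin_perm (sz u, f)"
  have "ap v = ap ?w \<circ> ap u"
    using sz_ap_abs_fin_perm[OF f] permutes_inv_o(2)[OF ap_permutes[of u]]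
    by (simp add: f_def o_assoc[symmetric])
  then show "weak_le u v"
    using R len_compose_eq_iff[of ?w u v] sz_ap_abs_fin_perm[OF f]
    unfolding weak_le_def by metis
qed

section \<open>The weak order as a partial order, and its Moebius function\<close>

lemma weak_le_refl [simp]: "weak_le u u"
  by (simp add: weak_le_iff)

lemma weak_le_trans: "weak_le u v \<Longrightarrow> weak_le v w \<Longrightarrow> weak_le u w"
  by (auto simp: weak_le_iff)

text \<open>The two are comparable by \<open>weak_le_iff\<close>, and comparable permutations of
  equal length coincide. Permutations are often identified below through their inversion
  sets.\<close>

lemma inversions_inject: "sz u = sz v \<Longrightarrow> inversions u = inversions v \<Longrightarrow> u = v"
  using weak_le_imp_len_less[of u v] by (auto simp: weak_le_iff len_def)

lemma weak_le_antisym: "weak_le u v \<Longrightarrow> weak_le v u \<Longrightarrow> u = v"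
  by (rule inversions_inject) (auto simp: weak_le_iff)

lemma finite_weak_ge: "finite {v. weak_le u v}"
  by (rule finite_subset[OF _ finite_fin_perm_sz[of "sz u"]]) (auto simp: weak_le_iff)

text \<open>The recursion for \<open>mobius u v\<close> is this identity solved for the term at
  \<open>v\<close>.\<close>

lemma sum_mobius:
  assumes "weak_le u v"
  shows "(\<Sum>z | weak_le u z \<and> weak_le z v. mobius u z) = (if u = v then 1 else 0)"
proof -
  have fin: "finite {z. weak_le u z \<and> weak_le z v}"
    by (rule finite_subset[OF _ finite_weak_ge[of u]]) auto
  show ?thesis
  proof (cases "u = v")
    case True
    then have "{z. weak_le u z \<and> weak_le z v} = {u}"
      using weak_le_antisym by auto
    then show ?thesis using True by (simp add: mobius.simps)
  next
    case False
    have "{z. weak_le u z \<and> weak_le z v \<and> z \<noteq> v} = {z. weak_le u z \<and> weak_le z v} - {v}"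
      by auto
    then show ?thesis
      using False assms fin mobius.simps[of u v]
      by (simp add: sum.remove[of _ v])
  qed
qed



section \<open>Standardization\<close>

text \<open>The witness sends a position to the rank of its letter. Existence is half of what the
  definite description in \<open>st\<close> requires.\<close>

lemma standardization_exists:
  fixes a :: "'a::linorder list"
  assumes "distinct a"
  shows "\<exists>u. sz u = length a \<and>
     (\<forall>i j. 1 \<le> i \<and> i \<le> length a \<and> 1 \<le> j \<and> j \<le> length a \<longrightarrow>
        (ap u i < ap u j \<longleftrightarrow> a ! (i - 1) < a ! (j - 1)))"
proof -
  define n where "n = length a"
  define r where "r x = card {k. k < n \<and> a ! k \<le> x}" for x
  \<comment> \<open>The identity outside \<open>{1..n}\<close> is what \<open>permutes\<close>
    demands.\<close>
  define f where "f i = (if i \<in> {1..n} then r (a ! (i - 1)) else i)" for i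
  \<comment> \<open>Position \<open>k\<close> is counted in the rank of its own letter but not in
    that of \<open>x\<close>.\<close>
  have r_less: "r x < r (a ! k)" if "x < a ! k" "k < n" for x k
    unfolding r_def
  proof (rule psubset_card_mono)
    have "k \<in> {k'. k' < n \<and> a ! k' \<le> a ! k}" "k \<notin> {k. k < n \<and> a ! k \<le> x}"
      using that by auto
    then show "{k. k < n \<and> a ! k \<le> x} \<subset> {k'. k' < n \<and> a ! k' \<le> a ! k}"
      using that by fastforce
  qed simp
  have pred_less: "i - 1 < n" if "i \<in> {1..n}" for i
    using that by auto
  have less_iff: "f i < f j \<longleftrightarrow> a ! (i - 1) < a ! (j - 1)" if "i \<in> {1..n}" "j \<in> {1..n}" for i j
    using that r_less[of "a ! (i - 1)" "j - 1", OF _ pred_less]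
      r_less[of "a ! (j - 1)" "i - 1", OF _ pred_less]
    by (cases "a ! (i - 1)" "a ! (j - 1)" rule: linorder_cases) (auto simp: f_def)
  have "inj_on f {1..n}"
  proof (rule inj_onI)
    fix i j assume ij: "i \<in> {1..n}" "j \<in> {1..n}" "f i = f j"
    then have "a ! (i - 1) = a ! (j - 1)"
      using less_iff[of i j] less_iff[of j i] by simp
    then have "i - 1 = j - 1"
      using ij assms by (subst (asm) nth_eq_iff_index_eq) (auto simp: n_def)
    then show "i = j" using ij by auto
  qed
  moreover have "f ` {1..n} \<subseteq> {1..n}"
  proof clarify
    fix i assume i: "i \<in> {1..n}"
    have "r (a ! (i - 1)) \<le> card {..<n}"
      unfolding r_def by (rule card_mono) auto
    moreover have "i - 1 \<in> {k. k < n \<and> a ! k \<le> a ! (i - 1)}"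
      using i by auto
    then have "r (a ! (i - 1)) \<noteq> 0"
      by (auto simp: r_def)
    ultimately show "f i \<in> {1..n}" using i by (simp add: f_def)
  qed
  ultimately have "bij_betw f {1..n} {1..n}"
    by (simp add: bij_betw_def endo_inj_surj)
  then have "f permutes {1..n}"
    by (rule bij_imp_permutes) (auto simp: f_def)
  from sz_ap_abs_fin_perm[OF this] show ?thesis
    using less_iff by (intro exI[of _ "abs_fin_perm (n, f)"]) (auto simp: n_def)
qed

text \<open>The conditions in \<open>st\<close> determine the inversions and hence, by
  \<open>inversions_inject\<close>, the permutation.\<close>

lemma
  assumes "distinct a"
  shows sz_st: "sz (st a) = length a"
    and inversions_st: "inversions (st a) =
      {(i, j). 1 \<le> i \<and> i < j \<and> j \<le> length a \<and> a ! (i - 1) > a ! (j - 1)}"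
proof -
  let ?P = "\<lambda>u. sz u = length a \<and>
     (\<forall>i j. 1 \<le> i \<and> i \<le> length a \<and> 1 \<le> j \<and> j \<le> length a \<longrightarrow>
        (ap u i < ap u j \<longleftrightarrow> a ! (i - 1) < a ! (j - 1)))"
  have inv: "inversions u = {(i, j). 1 \<le> i \<and> i < j \<and> j \<le> length a \<and> a ! (i - 1) > a ! (j - 1)}"
    if "?P u" for u
    using that by (auto simp: inversions_def)
  have "\<exists>!u. ?P u"
  proof (rule ex_ex1I)
    show "\<exists>u. ?P u" by (rule standardization_exists[OF assms])
    show "u = v" if "?P u" "?P v" for u v
      by (rule inversions_inject) (use that inv[OF that(1)] inv[OF that(2)] in auto)
  qed
  then have P: "?P (st a)"
    unfolding st_def by (rule theI')
  then show "sz (st a) = length a" by blast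
  show "inversions (st a) =
      {(i, j). 1 \<le> i \<and> i < j \<and> j \<le> length a \<and> a ! (i - 1) > a ! (j - 1)}"
    by (rule inv[OF P])
qed

section \<open>Inversions of the standardized ends of a word\<close>

lemma length_word [simp]: "length (word u) = sz u"
  by (simp add: word_def)

lemma nth_word: "k < sz u \<Longrightarrow> word u ! k = ap u (Suc k)"
  by (simp add: word_def del: upt_Suc)

lemma distinct_word [simp]: "distinct (word u)"
  by (simp add: word_def distinct_map inj_on_def del: upt_Suc)

lemma sz_st_take [simp]: "p \<le> sz u \<Longrightarrow> sz (st (take p (word u))) = p"
  by (simp add: sz_st)

lemma sz_st_drop [simp]: "sz (st (drop p (word u))) = sz u - p"
  by (simp add: sz_st)

lemma inversions_st_take:
  "p \<le> sz u \<Longrightarrow> inversions (st (take p (word u))) = {(i, j). (i, j) \<in> inversions u \<and> j \<le> p}"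
  by (auto simp: inversions_st nth_word) (auto simp: inversions_def nth_word)

lemma inversions_st_drop:
  "p \<le> sz u \<Longrightarrow> inversions (st (drop p (word u))) =
     {(i, j). 1 \<le> i \<and> (p + i, p + j) \<in> inversions u}"
  by (auto simp: inversions_st nth_word) (auto simp: inversions_def nth_word)



section \<open>Concatenation at a global descent\<close>

text \<open>The first block is raised by \<open>sz b\<close> to lie above the second. Position 0 is
  treated apart because the function has to fix it.\<close>

definition over :: "fin_perm \<Rightarrow> fin_perm \<Rightarrow> fin_perm" where
  "over a b = abs_fin_perm (sz a + sz b,
     \<lambda>i. if i \<le> sz a then (if i = 0 then 0 else ap a i + sz b)
         else if i \<le> sz a + sz b then ap b (i - sz a) else i)"

lemma
  shows sz_over [simp]: "sz (over a b) = sz a + sz b"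
    and ap_over: "ap (over a b) =
     (\<lambda>i. if i \<le> sz a then (if i = 0 then 0 else ap a i + sz b)
         else if i \<le> sz a + sz b then ap b (i - sz a) else i)" (is "_ = ?f")
proof -
  have a: "1 \<le> ap a i \<and> ap a i \<le> sz a" if "1 \<le> i" "i \<le> sz a" for i
    using ap_in_iff[of a i] that by simp
  have b: "1 \<le> ap b i \<and> ap b i \<le> sz b" if "1 \<le> i" "i \<le> sz b" for i
    using ap_in_iff[of b i] that by simp
  \<comment> \<open>Across the cut the values differ since the first block lies above
    \<open>sz b\<close> and the second does not.\<close>
  have "?f i \<noteq> ?f j" if "i \<in> {1..sz a + sz b}" "j \<in> {1..sz a + sz b}" "i < j" for i j
  proof -
    have "j - sz a \<noteq> 0 \<Longrightarrow> 1 \<le> j - sz a \<and> j - sz a \<le> sz b"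
      using that by auto
    then show ?thesis using that a[of i] b[of "j - sz a"] by auto
  qed
  then have "inj_on ?f {1..sz a + sz b}"
    by (intro linorder_inj_onI') blast
  moreover have "?f i \<in> {1..sz a + sz b}" if "i \<in> {1..sz a + sz b}" for i
  proof (cases "i \<le> sz a")
    case False
    then have "1 \<le> i - sz a \<and> i - sz a \<le> sz b" using that by auto
    then show ?thesis using b[of "i - sz a"] False that by auto
  qed (use that a[of i] in auto)
  then have "?f ` {1..sz a + sz b} \<subseteq> {1..sz a + sz b}" by blast
  ultimately have "bij_betw ?f {1..sz a + sz b} {1..sz a + sz b}"
    by (simp only: bij_betw_def endo_inj_surj finite_atLeastAtMost)
  then have "?f permutes {1..sz a + sz b}"
    by (rule bij_imp_permutes) auto
  from sz_ap_abs_fin_perm[OF this]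
  show "sz (over a b) = sz a + sz b" "ap (over a b) = ?f"
    by (simp_all add: over_def)
qed

text \<open>Letters of the first block exceed those of the second, so every pair across the cut is
  inverted.\<close>

lemma mem_inversions_over:
  "(i, j) \<in> inversions (over a b) \<longleftrightarrow>
     (i, j) \<in> inversions a \<or> (1 \<le> i \<and> i \<le> sz a \<and> sz a < j \<and> j \<le> sz a + sz b) \<or>
     (sz a < i \<and> (i - sz a, j - sz a) \<in> inversions b)"
proof -
  have "ap b (j - sz a) < ap a i + sz b" if "1 \<le> i" "i \<le> sz a" "sz a < j" "j \<le> sz a + sz b"
    using ap_in_iff[of a i] ap_in_iff[of b "j - sz a"] that by auto
  then show ?thesis
    by (auto simp: inversions_def ap_over)
qed

lemma inversions_bounds: "(i, j) \<in> inversions u \<Longrightarrow> 1 \<le> i \<and> i < j \<and> j \<le> sz u"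
  by (simp add: inversions_def)

lemma over_assoc: "over (over a b) c = over a (over b c)"
  by (rule fin_perm_eqI) (auto simp: ap_over fun_eq_iff)

lemma over_inject:
  assumes "over a b = over a' b'" "sz a = sz a'"
  shows "a = a' \<and> b = b'"
proof -
  have sz: "sz b = sz b'"
    using arg_cong[OF assms(1), of sz] assms(2) by simp
  have *: "ap (over a b) i = ap (over a' b') i" for i
    using assms(1) by simp
  have "ap a i = ap a' i" for i
    using *[of i] assms(2) sz
    by (cases "i \<in> {1..sz a}") (auto simp: ap_over ap_outside)
  moreover have "ap b i = ap b' i" for i
    using *[of "i + sz a"] assms(2) sz
    by (cases "i \<in> {1..sz b}") (auto simp: ap_over ap_outside)
  ultimately show ?thesis
    using assms(2) sz by (auto intro!: fin_perm_eqI)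
qed

text \<open>The key to the coproduct formula. All pairs across the cut are inversions of
  \<open>over a b\<close>, so containment of inversion sets constrains only the pairs inside one of
  the two blocks.\<close>

lemma weak_le_over_iff:
  "weak_le u (over a b) \<longleftrightarrow> sz u = sz a + sz b \<and>
     weak_le (st (take (sz a) (word u))) a \<and> weak_le (st (drop (sz a) (word u))) b"
proof (cases "sz u = sz a + sz b")
  case True
  have "inversions u \<subseteq> inversions (over a b) \<longleftrightarrow>
    (\<forall>i j. (i, j) \<in> inversions u \<and> j \<le> sz a \<longrightarrow> (i, j) \<in> inversions a) \<and>
    (\<forall>i j. 1 \<le> i \<and> (sz a + i, sz a + j) \<in> inversions u \<longrightarrow> (i, j) \<in> inversions b)"
    (is "?L \<longleftrightarrow> ?A \<and> ?B")
  proof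
    assume ?L
    then have L: "(i, j) \<in> inversions u \<Longrightarrow> (i, j) \<in> inversions (over a b)" for i j by auto
    show "?A \<and> ?B"
    proof (intro conjI allI impI; elim conjE)
      fix i j assume "(i, j) \<in> inversions u" "j \<le> sz a"
      then show "(i, j) \<in> inversions a"
        using L[of i j] inversions_bounds[of i j u] by (auto simp: mem_inversions_over)
    next
      fix i j assume "1 \<le> i" "(sz a + i, sz a + j) \<in> inversions u"
      \<comment> \<open>Such a pair lies beyond position \<open>sz a\<close>, so it is no inversion
        of \<open>a\<close>.\<close>
      then show "(i, j) \<in> inversions b"
        using L[of "sz a + i" "sz a + j"] inversions_bounds[of "sz a + i" "sz a + j" a]
        by (auto simp: mem_inversions_over)
    qed
  next
    assume R: "?A \<and> ?B"
    show ?L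
    proof clarify
      fix i j assume ij: "(i, j) \<in> inversions u"
      note bd = inversions_bounds[OF ij]
      consider "j \<le> sz a" | "i \<le> sz a" "sz a < j" | "sz a < i" by linarith
      then show "(i, j) \<in> inversions (over a b)"
      proof cases
        case 3
        then have "1 \<le> i - sz a" "(sz a + (i - sz a), sz a + (j - sz a)) \<in> inversions u"
          using ij bd by auto
        then show ?thesis using R 3 unfolding mem_inversions_over by blast
      qed (use R ij bd True in \<open>auto simp: mem_inversions_over\<close>)
    qed
  qed
  then show ?thesis
    using True by (auto simp: weak_le_iff inversions_st_take inversions_st_drop)
qed (simp add: weak_le_iff)

section \<open>Global descents as cut points of products\<close>

lemma mem_global_descents_iff:
  "p \<in> global_descents u \<longleftrightarrow> 1 \<le> p \<and> p < sz u \<and>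
     (\<forall>i j. 1 \<le> i \<and> i \<le> p \<and> p < j \<and> j \<le> sz u \<longrightarrow> (i, j) \<in> inversions u)"
  by (auto simp: global_descents_def inversions_def)

text \<open>At a global descent all pairs across the cut are inversions of \<open>u\<close>, exactly
  the pairs that \<open>over\<close> adds to those of the blocks.\<close>

lemma over_st_take_drop:
  assumes "p \<in> global_descents u"
  shows "over (st (take p (word u))) (st (drop p (word u))) = u"
proof (rule inversions_inject)
  have p: "p \<le> sz u" "\<And>i j. 1 \<le> i \<Longrightarrow> i \<le> p \<Longrightarrow> p < j \<Longrightarrow> j \<le> sz u \<Longrightarrow> (i, j) \<in> inversions u"
    using assms by (auto simp: mem_global_descents_iff)
  show "sz (over (st (take p (word u))) (st (drop p (word u)))) = sz u"
    using p(1) by simp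
  show "inversions (over (st (take p (word u))) (st (drop p (word u)))) = inversions u"
  proof (rule set_eqI, clarify)
    fix i j
    show "(i, j) \<in> inversions (over (st (take p (word u))) (st (drop p (word u)))) \<longleftrightarrow>
      (i, j) \<in> inversions u"
    proof (cases "1 \<le> i \<and> i < j \<and> j \<le> sz u")
      case True
      consider "j \<le> p" | "i \<le> p" "p < j" | "p < i" by linarith
      then show ?thesis
        by cases (use True p in \<open>auto simp: mem_inversions_over inversions_st_take inversions_st_drop\<close>)
    next
      case False
      then show ?thesis
        using p(1) inversions_bounds[of i j u]
          inversions_bounds[of i j "over (st (take p (word u))) (st (drop p (word u)))"]
        by auto
    qed
  qed
qed

text \<open>Pairs across the blocks are inverted, so a cut inside one block is tested on that block
  alone, and the cut between two nonempty blocks is always a global descent.\<close>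

lemma global_descents_over:
  "global_descents (over a b) =
     global_descents a \<union> (if sz a \<ge> 1 \<and> sz b \<ge> 1 then {sz a} else {}) \<union>
     (+) (sz a) ` global_descents b"
proof (rule set_eqI)
  fix p
  consider "p < sz a" | "p = sz a" | "sz a < p" by linarith
  then show "p \<in> global_descents (over a b) \<longleftrightarrow> p \<in> global_descents a \<union>
     (if sz a \<ge> 1 \<and> sz b \<ge> 1 then {sz a} else {}) \<union> (+) (sz a) ` global_descents b"
  proof cases
    case 1
    have "p \<in> global_descents (over a b) \<longleftrightarrow> p \<in> global_descents a"
    proof
      assume p: "p \<in> global_descents (over a b)"
      have "(i, j) \<in> inversions a" if "1 \<le> i" "i \<le> p" "p < j" "j \<le> sz a" for i j
      proof -
        have "(i, j) \<in> inversions (over a b)"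
          using p that unfolding mem_global_descents_iff by auto
        then show ?thesis using that 1 by (auto simp: mem_inversions_over)
      qed
      then show "p \<in> global_descents a"
        using p 1 by (auto simp: mem_global_descents_iff)
    next
      assume p: "p \<in> global_descents a"
      then have "(i, j) \<in> inversions (over a b)"
        if "1 \<le> i" "i \<le> p" "p < j" "j \<le> sz a + sz b" for i j
        using that 1 by (cases "j \<le> sz a") (auto simp: mem_global_descents_iff mem_inversions_over)
      then show "p \<in> global_descents (over a b)"
        using p 1 by (auto simp: mem_global_descents_iff)
    qed
    then show ?thesis using 1 by auto
  next
    case 2
    then show ?thesis
      by (auto simp: mem_global_descents_iff mem_inversions_over)
  next
    case 3
    have "p \<in> global_descents (over a b) \<longleftrightarrow> p - sz a \<in> global_descents b"
    proof
      assume p: "p \<in> global_descents (over a b)"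
      have "(i, j) \<in> inversions b" if "1 \<le> i" "i \<le> p - sz a" "p - sz a < j" "j \<le> sz b" for i j
      proof -
        have "(i + sz a, j + sz a) \<in> inversions (over a b)"
          by (rule p[unfolded mem_global_descents_iff, THEN conjunct2, THEN conjunct2, rule_format])
            (use that 3 in auto)
        then show ?thesis using that 3 by (auto simp: mem_inversions_over dest: inversions_bounds)
      qed
      then show "p - sz a \<in> global_descents b"
        using p 3 by (auto simp: mem_global_descents_iff)
    next
      assume p: "p - sz a \<in> global_descents b"
      then have "(i, j) \<in> inversions (over a b)"
        if "1 \<le> i" "i \<le> p" "p < j" "j \<le> sz a + sz b" for i j
      proof (cases "i \<le> sz a")
        case False
        have "(i - sz a, j - sz a) \<in> inversions b"
          by (rule p[unfolded mem_global_descents_iff, THEN conjunct2, THEN conjunct2, rule_format])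
            (use that False 3 in auto)
        then show ?thesis using False by (simp add: mem_inversions_over)
      qed (use that 3 in \<open>auto simp: mem_inversions_over\<close>)
      then show "p \<in> global_descents (over a b)"
        using p 3 by (auto simp: mem_global_descents_iff)
    qed
    moreover have "p \<in> (+) (sz a) ` B \<longleftrightarrow> p - sz a \<in> B" for B
      using 3 by (auto simp: image_iff intro!: bexI[of _ "p - sz a"])
    ultimately show ?thesis using 3 by (auto simp: mem_global_descents_iff)
  qed
qed

lemma finite_global_descents [simp]: "finite (global_descents u)"
  by (simp add: global_descents_def)

lemma card_global_descents_over:
  assumes "sz a \<ge> 1" "sz b \<ge> 1"
  shows "card (global_descents (over a b)) =
    Suc (card (global_descents a) + card (global_descents b))"
proof -
  \<comment> \<open>Global descents of \<open>a\<close> lie below \<open>sz a\<close>, the shifted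
    ones of \<open>b\<close> above it.\<close>
  have "sz a \<notin> global_descents a" "sz a \<notin> (+) (sz a) ` global_descents b"
    "global_descents a \<inter> (+) (sz a) ` global_descents b = {}"
    by (auto simp: mem_global_descents_iff)
  then show ?thesis
    using assms by (simp add: global_descents_over card_Un_disjoint card_image)
qed



section \<open>Unique factorization into permutations without global descents\<close>

text \<open>These are the elements of \<open>perm_grade 1\<close> and form the alphabet of the
  words. Excluding the empty permutation, a unit for \<open>over\<close>, makes unique factorization
  possible.\<close>

definition indecomposables :: "fin_perm set" where
  "indecomposables = {u. sz u \<ge> 1 \<and> global_descents u = {}}"

definition empty_perm :: fin_perm where
  "empty_perm = abs_fin_perm (0, id)"

fun over_list :: "fin_perm list \<Rightarrow> fin_perm" where
  "over_list [] = empty_perm"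
| "over_list (u # us) = over u (over_list us)"

lemma sz_empty_perm [simp]: "sz empty_perm = 0"
  by (simp add: empty_perm_def sz_ap_abs_fin_perm permutes_id)

lemma sz_0_iff [simp]: "sz u = 0 \<longleftrightarrow> u = empty_perm"
  using inversions_inject[of u empty_perm] by (auto simp: inversions_def)

lemma over_empty_perm [simp]: "over empty_perm u = u" "over u empty_perm = u"
  by (rule fin_perm_eqI; auto simp: ap_over fun_eq_iff ap_outside simp del: sz_0_iff)+

lemma over_list_append: "over_list (us @ vs) = over (over_list us) (over_list vs)"
  by (induction us) (simp_all add: over_assoc)

text \<open>Each factor after the first adds one global descent, at its boundary.\<close>

lemma over_list_in_grade:
  "us \<in> lists indecomposables \<Longrightarrow> over_list us \<in> perm_grade (length us)"
proof (induction us)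
  case (Cons u us)
  then have u: "sz u \<ge> 1" "global_descents u = {}"
    and us: "over_list us \<in> perm_grade (length us)"
    by (auto simp: indecomposables_def)
  show ?case
  proof (cases us)
    case Nil
    then show ?thesis using u by (simp add: perm_grade_def)
  next
    case (Cons v vs)
    then have "sz (over_list us) \<ge> 1" "card (global_descents (over_list us)) = length us - 1"
      using us by (auto simp: perm_grade_def)
    then show ?thesis
      using u Cons card_global_descents_over[of u "over_list us"] by (simp add: perm_grade_def)
  qed
qed (simp add: perm_grade_def)

text \<open>If \<open>a\<close> were shorter than \<open>a'\<close>, the cut after \<open>a\<close>
  would be a global descent inside \<open>a'\<close>, which has none.\<close>

lemma over_indecomposable_inject:
  assumes "over a b = over a' b'" "a \<in> indecomposables" "a' \<in> indecomposables"
  shows "a = a' \<and> b = b'"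
proof -
  have not_less: "\<not> sz a < sz a'"
    if "over a b = over a' b'" "a \<in> indecomposables" "a' \<in> indecomposables" for a b a' b'
  proof
    assume less: "sz a < sz a'"
    \<comment> \<open>The total sizes agree, so \<open>b\<close> is nonempty and the cut after
      \<open>a\<close> is a global descent.\<close>
    have "sz b \<ge> 1" using arg_cong[OF that(1), of sz] less by simp
    then have "sz a \<in> global_descents (over a b)"
      using that(2) by (simp add: global_descents_over indecomposables_def)
    then show False
      using that less by (auto simp: global_descents_over indecomposables_def split: if_splits)
  qed
  have "sz a = sz a'"
    using not_less[OF assms] not_less[OF assms(1)[symmetric] assms(3,2)] by simp
  with assms(1) show ?thesis by (rule over_inject)
qed

lemma inj_on_over_list: "inj_on over_list (lists indecomposables)"
proof (rule inj_onI)
  fix us vs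
  assume "us \<in> lists indecomposables" "vs \<in> lists indecomposables" "over_list us = over_list vs"
  then show "us = vs"
  proof (induction us arbitrary: vs)
    case Nil
    \<comment> \<open>A nonempty word has positive grade, so its product is not
      \<open>empty_perm\<close>.\<close>
    then show ?case
      using over_list_in_grade[of vs] by (cases vs) (auto simp: perm_grade_def)
  next
    case (Cons u us)
    show ?case
    proof (cases vs)
      case Nil
      then show ?thesis
        using Cons.hyps Cons.prems over_list_in_grade[of "u # us"] by (simp add: perm_grade_def)
    next
      case (Cons v vs')
      then show ?thesis
        using Cons.hyps Cons.prems Cons.IH[of vs'] over_indecomposable_inject[of u "over_list us" v "over_list vs'"]
        by auto
    qed
  qed
qed

text \<open>Cutting at any global descent leaves two strictly shorter pieces.\<close>

lemma over_list_surj: "\<exists>us\<in>lists indecomposables. over_list us = u"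
proof (induction "sz u" arbitrary: u rule: less_induct)
  case less
  show ?case
  proof (cases "global_descents u = {}")
    case True
    show ?thesis
    proof (cases "u = empty_perm")
      case False
      then have "u \<in> indecomposables"
        using True sz_0_iff[of u] by (simp add: indecomposables_def del: sz_0_iff)
      then show ?thesis by (intro bexI[of _ "[u]"]) auto
    qed (auto intro!: bexI[of _ "[]"])
  next
    case False
    then obtain p where p: "p \<in> global_descents u" by auto
    then have "1 \<le> p" "p < sz u" by (auto simp: mem_global_descents_iff)
    then obtain us vs where "us \<in> lists indecomposables" "over_list us = st (take p (word u))"
      "vs \<in> lists indecomposables" "over_list vs = st (drop p (word u))"
      using less[of "st (take p (word u))"] less[of "st (drop p (word u))"] by auto
    then show ?thesis
      using over_st_take_drop[OF p] by (intro bexI[of _ "us @ vs"]) (auto simp: over_list_append)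
  qed
qed

text \<open>The grade of a product is the number of its factors, and distinct grades share no
  permutation.\<close>

lemma perm_grade_eq: "perm_grade k = over_list ` {us \<in> lists indecomposables. length us = k}"
proof
  show "over_list ` {us \<in> lists indecomposables. length us = k} \<subseteq> perm_grade k"
    using over_list_in_grade by blast
  show "perm_grade k \<subseteq> over_list ` {us \<in> lists indecomposables. length us = k}"
  proof
    fix u assume u: "u \<in> perm_grade k"
    obtain us where us: "us \<in> lists indecomposables" "over_list us = u"
      using over_list_surj by blast
    have "u \<in> perm_grade (length us)"
      using over_list_in_grade[OF us(1)] us(2) by simp
    then have "length us = k"
      using u by (cases us) (auto simp: perm_grade_def split: if_splits)
    then show "u \<in> over_list ` {us \<in> lists indecomposables. length us = k}"
      using us by blast
  qed
qed


section \<open>The isomorphism with the deconcatenation coalgebra\<close>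

text \<open>
  In the basis \<open>\<M>\<close> this map sends \<open>\<M> u\<close> to the word of indecomposable factors of \<open>u\<close>;
  the definition uses that \<open>\<F> u\<close> is the sum of all \<open>\<M> v\<close> with \<open>v \<ge> u\<close>.
\<close>

definition to_words :: "ssym \<Rightarrow> (fin_perm list \<Rightarrow>\<^sub>0 rat)" where
  "to_words = lin_ext (\<lambda>u. \<Sum>w | w \<in> lists indecomposables \<and> weak_le u (over_list w). basis w)"

text \<open>Inverse to \<open>to_words\<close> on combinations of words over
  \<open>indecomposables\<close>.\<close>

definition of_words :: "(fin_perm list \<Rightarrow>\<^sub>0 rat) \<Rightarrow> ssym" where
  "of_words = lin_ext (\<lambda>w. \<M> (over_list w))"

interpretation to_words: Vector_Spaces.linear scl scl to_words
  unfolding to_words_def by (rule linear_lin_ext)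

interpretation of_words: Vector_Spaces.linear scl scl of_words
  unfolding of_words_def by (rule linear_lin_ext)

section \<open>Coefficients of \<open>to_words\<close>, Moebius inversion and bijectivity\<close>

lemma of_words_basis: "of_words (basis w) = \<M> (over_list w)"
  by (simp add: of_words_def)

text \<open>The defining sum has this value because its index set is finite: by unique factorization
  the words embed into the permutations above \<open>u\<close>.\<close>

lemma lookup_to_words_basis:
  "coef (to_words (\<F> u)) w = of_bool (w \<in> lists indecomposables \<and> weak_le u (over_list w))"
proof -
  let ?W = "{w. w \<in> lists indecomposables \<and> weak_le u (over_list w)}"
  have "finite ?W"
  proof (rule finite_imageD)
    show "finite (over_list ` ?W)"
      by (rule finite_subset[OF _ finite_weak_ge[of u]]) auto
    show "inj_on over_list ?W"
      by (rule inj_on_subset[OF inj_on_over_list]) auto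
  qed
  then show ?thesis
    by (simp add: to_words_def lookup_sum lookup_basis)
qed

lemma lookup_to_words:
  "coef (to_words x) w = (if w \<in> lists indecomposables
     then \<Sum>u\<in>supp x. if weak_le u (over_list w) then coef x u else 0 else 0)"
proof -
  have "coef (to_words x) w = (\<Sum>u\<in>supp x. coef x u * coef (to_words (\<F> u)) w)"
    by (simp add: to_words_def lookup_lin_ext)
  also have "\<dots> = (\<Sum>u\<in>supp x.
      if w \<in> lists indecomposables \<and> weak_le u (over_list w) then coef x u else 0)"
    unfolding lookup_to_words_basis by (intro sum.cong refl) simp
  finally show ?thesis
    by (cases "w \<in> lists indecomposables") simp_all
qed

lemma supp_to_words: "supp (to_words x) \<subseteq> lists indecomposables"
  by (auto simp: in_keys_iff lookup_to_words split: if_splits)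

text \<open>Moebius inversion: the coefficient sums \<open>mobius u\<close> over the interval from
  \<open>u\<close> to \<open>over_list w\<close>.\<close>

lemma lookup_to_words_Monom:
  "coef (to_words (\<M> u)) w = of_bool (w \<in> lists indecomposables \<and> u = over_list w)"
proof (cases "w \<in> lists indecomposables")
  case True
  have "coef (to_words (\<M> u)) w =
      (\<Sum>v | weak_le u v. if weak_le v (over_list w) then of_int (mobius u v) else 0)"
    unfolding Monom_def to_words.sum to_words.scale lookup_sum lookup_scl lookup_to_words_basis
    using True by (intro sum.cong) auto
  also have "\<dots> = (\<Sum>v | weak_le u v \<and> weak_le v (over_list w). of_int (mobius u v))"
    using finite_weak_ge by (simp add: sum.inter_filter[symmetric])
  also have "\<dots> = of_bool (u = over_list w)"
  proof (cases "weak_le u (over_list w)")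
    case True
    then show ?thesis
      using sum_mobius[OF True] by (simp flip: of_int_sum)
  next
    case False
    then have empty: "{v. weak_le u v \<and> weak_le v (over_list w)} = {}" and "u \<noteq> over_list w"
      using weak_le_trans by auto
    then show ?thesis unfolding empty by simp
  qed
  finally show ?thesis using True by simp
qed (simp add: lookup_to_words)

lemma to_words_Monom_over_list:
  assumes "w \<in> lists indecomposables"
  shows "to_words (\<M> (over_list w)) = basis w"
  using assms inj_on_over_list
  by (intro poly_mapping_eqI) (auto simp: lookup_to_words_Monom lookup_basis inj_on_eq_iff)

lemma to_words_of_words:
  assumes "supp y \<subseteq> lists indecomposables"
  shows "to_words (of_words y) = y"
proof -
  have "to_words (of_words y) = (\<Sum>w\<in>supp y. scl (coef y w) (to_words (\<M> (over_list w))))"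
    by (simp add: of_words_def lin_ext_def to_words.sum to_words.scale)
  also have "\<dots> = (\<Sum>w\<in>supp y. scl (coef y w) (basis w))"
  proof (intro sum.cong refl)
    fix w assume "w \<in> supp y"
    then have "w \<in> lists indecomposables" using assms by blast
    then show "scl (coef y w) (to_words (\<M> (over_list w))) = scl (coef y w) (basis w)"
      by (simp only: to_words_Monom_over_list)
  qed
  finally show ?thesis by (simp add: sum_coef_basis)
qed

text \<open>
  At a shortest permutation in the support of \<open>x\<close>, the word of its factors has the same coefficient
  in \<open>to_words x\<close>.
\<close>

lemma to_words_eq_0_imp:
  assumes "to_words x = 0"
  shows "x = 0"
proof (rule ccontr)
  assume "x \<noteq> 0"
  then have "\<exists>u. u \<in> supp x" using keys_eq_empty by blast
  then obtain u where u: "u \<in> supp x" and min: "\<And>v. v \<in> supp x \<Longrightarrow> len u \<le> len v"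
    using arg_min_natI[of "\<lambda>u. u \<in> supp x" _ len] arg_min_nat_le[of "\<lambda>u. u \<in> supp x" _ len]
    by blast
  obtain w where w: "w \<in> lists indecomposables" "over_list w = u"
    using over_list_surj by blast
  \<comment> \<open>Anything strictly below \<open>u\<close> is shorter, against the choice of
    \<open>u\<close>.\<close>
  have "weak_le v u \<longleftrightarrow> v = u" if "v \<in> supp x" for v
    using min[OF that] weak_le_imp_len_less[of v u] by auto
  then have "(\<Sum>v\<in>supp x. if weak_le v u then coef x v else 0) =
      (\<Sum>v\<in>supp x. if v = u then coef x v else 0)"
    by (intro sum.cong) auto
  then have "coef (to_words x) w = coef x u"
    using w u by (simp add: lookup_to_words)
  then show False using assms u by (simp add: in_keys_iff)
qed

lemma inj_to_words: "inj to_words"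
proof (rule injI)
  fix x y assume "to_words x = to_words y"
  then have "to_words (x - y) = 0" by (simp add: to_words.diff)
  then show "x = y" using to_words_eq_0_imp[of "x - y"] by simp
qed

text \<open>A right inverse of an injective map is also a left inverse.\<close>

lemma of_words_to_words: "of_words (to_words x) = x"
  using to_words_of_words[OF supp_to_words] inj_to_words by (simp add: inj_eq)

section \<open>Compatibility with the coproducts and counits\<close>

lemma linear_ssym_coproduct: "Vector_Spaces.linear scl scl ssym_coproduct"
  unfolding ssym_coproduct_def by (rule linear_lin_ext)

text \<open>Coefficients at \<open>(w, w')\<close> are compared for each \<open>\<F> u\<close>. Only
  the cut at the size of \<open>over_list w\<close> can contribute, since the weak order compares
  equal sizes, and there \<open>weak_le_over_iff\<close> gives equality.\<close>

lemma deconcatenation_to_words: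
  "deconcatenation (to_words x) = tensor_map to_words to_words (ssym_coproduct x)"
proof (rule linear_eqI[of "\<lambda>x. deconcatenation (to_words x)"])
  show "Vector_Spaces.linear scl scl (\<lambda>x. deconcatenation (to_words x))"
    by (rule linear_compose_apply[OF to_words.linear_axioms linear_deconcatenation])
  show "Vector_Spaces.linear scl scl (\<lambda>x. tensor_map to_words to_words (ssym_coproduct x))"
    by (rule linear_compose_apply[OF linear_ssym_coproduct linear_tensor_map])
  interpret tm: Vector_Spaces.linear scl scl "tensor_map to_words to_words"
    by (rule linear_tensor_map)
  fix u
  show "deconcatenation (to_words (\<F> u)) = tensor_map to_words to_words (ssym_coproduct (\<F> u))"
  proof (rule poly_mapping_eqI)
    fix q :: "fin_perm list \<times> fin_perm list"
    obtain w w' where q: "q = (w, w')" by (cases q)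
    let ?c = "of_bool (w @ w' \<in> lists indecomposables \<and> weak_le u (over_list (w @ w'))) :: rat"
    let ?t = "\<lambda>p. coef (to_words (\<F> (st (take p (word u))))) w *
      coef (to_words (\<F> (st (drop p (word u))))) w'"
    have "ssym_coproduct (\<F> u) =
        (\<Sum>p=0..sz u. tensor (\<F> (st (take p (word u)))) (\<F> (st (drop p (word u)))))"
      by (simp add: ssym_coproduct_def)
    then have "coef (tensor_map to_words to_words (ssym_coproduct (\<F> u))) q = (\<Sum>p=0..sz u. ?t p)"
      by (simp add: tm.sum lookup_sum q lookup_tensor tensor_map_tensor to_words.linear_axioms)
    also have "\<dots> = (\<Sum>p=0..sz u. if p = sz (over_list w) then ?c else 0)"
    proof (intro sum.cong refl)
      fix p assume "p \<in> {0..sz u}"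
      then have p: "p \<le> sz u" by simp
      show "?t p = (if p = sz (over_list w) then ?c else 0)"
      proof (cases "p = sz (over_list w)")
        case True
        \<comment> \<open>Supplies the size condition of \<open>weak_le_over_iff\<close> from the
          second comparison.\<close>
        have "sz u = p + sz (over_list w')" if "weak_le (st (drop p (word u))) (over_list w')"
          using that p by (auto simp: weak_le_iff)
        then have "weak_le u (over_list (w @ w')) \<longleftrightarrow>
            weak_le (st (take p (word u))) (over_list w) \<and>
            weak_le (st (drop p (word u))) (over_list w')"
          unfolding over_list_append weak_le_over_iff True[symmetric] by blast
        then show ?thesis
          unfolding if_P[OF True] lookup_to_words_basis by (simp add: of_bool_conj mult_ac)
      next
        case False
        then show ?thesis using p by (auto simp: lookup_to_words_basis weak_le_iff)
      qed
    qed
    \<comment> \<open>If \<open>?c\<close> is nonzero the sizes add up to \<open>sz u\<close>, so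
      the cut lies in the range of summation.\<close>
    also have "\<dots> = ?c"
      by (auto simp: over_list_append weak_le_over_iff)
    also have "\<dots> = coef (deconcatenation (to_words (\<F> u))) q"
      by (simp add: q lookup_deconcatenation lookup_to_words_basis)
    finally show "coef (deconcatenation (to_words (\<F> u))) q =
      coef (tensor_map to_words to_words (ssym_coproduct (\<F> u))) q" ..
  qed
qed

text \<open>The empty word has product \<open>empty_perm\<close>, which is comparable only with
  itself.\<close>

lemma Q_counit_to_words: "Q_counit (to_words x) = ssym_counit x"
proof -
  have "weak_le u empty_perm \<longleftrightarrow> u = empty_perm" for u
    using sz_0_iff[of u] by (auto simp: weak_le_iff simp del: sz_0_iff)
  then show ?thesis
    by (simp add: Q_counit_def lookup_to_words ssym_counit_def if_distrib[of "(*) _"] cong: if_cong)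
qed

text \<open>Transports deconcatenation back, so that the coproduct of a graded piece can be read off
  from words.\<close>

lemma ssym_coproduct_eq:
  "ssym_coproduct x = tensor_map of_words of_words (deconcatenation (to_words x))"
proof -
  have "tensor_map of_words of_words (tensor_map to_words to_words y) = y" for y
  proof (rule linear_eqI[of _ "\<lambda>y. y"])
    show "Vector_Spaces.linear scl scl
        (\<lambda>y. tensor_map of_words of_words (tensor_map to_words to_words y))"
      by (rule linear_compose_apply[OF linear_tensor_map linear_tensor_map])
    show "Vector_Spaces.linear scl scl (\<lambda>y :: fin_perm \<times> fin_perm \<Rightarrow>\<^sub>0 rat. y)"
      by (rule fvs.linear_ident)
    show "tensor_map of_words of_words (tensor_map to_words to_words (basis p)) = basis p" for p
      by (cases p) (simp add: tensor_map_basis tensor_map_tensor of_words.linear_axioms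
          of_words_to_words tensor_basis)
  qed
  then show ?thesis by (simp add: deconcatenation_to_words)
qed

section \<open>The grading as the grading by word length\<close>

lemma to_words_image_grade:
  "to_words ` ssym_grade k = fvs.span (basis ` {w \<in> lists indecomposables. length w = k})"
proof -
  have "to_words ` \<M> ` perm_grade k = basis ` {w \<in> lists indecomposables. length w = k}"
    unfolding perm_grade_eq image_image by (intro image_cong) (auto simp: to_words_Monom_over_list)
  then show ?thesis
    by (simp add: ssym_grade_def to_words.span_image[symmetric])
qed

lemma mem_ssym_grade_iff: "x \<in> ssym_grade k \<longleftrightarrow> supp (to_words x) \<subseteq> {w. length w = k}"
proof -
  have "x \<in> ssym_grade k \<longleftrightarrow> to_words x \<in> to_words ` ssym_grade k"
    using inj_to_words by (simp add: inj_image_mem_iff)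
  then show ?thesis
    using supp_to_words[of x] by (auto simp: to_words_image_grade span_basis)
qed

text \<open>The component of \<open>x\<close> in grade \<open>k\<close> comes from the part of
  \<open>to_words x\<close> on words of length \<open>k\<close>.\<close>

lemma ssym_direct_sum: "direct_sum_decomposition ssym_grade"
  unfolding direct_sum_decomposition_def
proof (intro conjI allI)
  show "fvs.subspace (ssym_grade k)" for k
    by (simp add: ssym_grade_def)
  fix x
  define part where "part k = lin_ext (\<lambda>w. if length w = k then basis w else 0) (to_words x)" for k
  have lookup_part: "coef (part k) w = (if length w = k then coef (to_words x) w else 0)" for k w
  proof -
    have "coef (part k) w =
        (\<Sum>w'\<in>supp (to_words x). if w' = w then (if length w = k then coef (to_words x) w else 0) else 0)"
      unfolding part_def lookup_lin_ext by (intro sum.cong) (auto simp: lookup_basis)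
    then show ?thesis by (simp add: in_keys_iff)
  qed
  have supp_part: "supp (part k) \<subseteq> lists indecomposables" for k
    using supp_to_words[of x] by (auto simp: in_keys_iff lookup_part subset_iff split: if_splits)
  note to_of_part = to_words_of_words[OF supp_part]
  have part_0: "of_words (part k) = 0 \<longleftrightarrow> part k = 0" for k
    using to_of_part[of k] of_words.zero to_words.zero by auto
  show "\<exists>!g. (\<forall>k. g k \<in> ssym_grade k) \<and> finite {k. g k \<noteq> 0} \<and> x = (\<Sum>k | g k \<noteq> 0. g k)"
  proof (rule ex1I[of _ "\<lambda>k. of_words (part k)"], intro conjI allI)
    show "of_words (part k) \<in> ssym_grade k" for k
      by (auto simp: mem_ssym_grade_iff to_of_part in_keys_iff lookup_part split: if_splits)
    \<comment> \<open>Only the finitely many lengths occurring in \<open>to_words x\<close> give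
      nonzero parts.\<close>
    have "k \<in> length ` supp (to_words x)" if "part k \<noteq> 0" for k
    proof (rule ccontr)
      assume "k \<notin> length ` supp (to_words x)"
      then have "part k = 0"
        by (intro poly_mapping_eqI) (auto simp: lookup_part in_keys_iff)
      with that show False by simp
    qed
    then have "{k. part k \<noteq> 0} \<subseteq> length ` supp (to_words x)" by blast
    then show fin: "finite {k. of_words (part k) \<noteq> 0}"
      unfolding part_0 by (rule finite_subset) simp
    have "to_words (\<Sum>k | of_words (part k) \<noteq> 0. of_words (part k)) = to_words x"
    proof (rule poly_mapping_eqI)
      fix w
      have "coef (to_words (\<Sum>k | of_words (part k) \<noteq> 0. of_words (part k))) w =
          (if part (length w) \<noteq> 0 then coef (to_words x) w else 0)"
        using fin by (simp add: to_words.sum to_of_part lookup_sum lookup_part part_0)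
      also have "\<dots> = coef (to_words x) w"
        using lookup_part[of "length w" w] by (cases "part (length w) = 0") simp_all
      finally show "coef (to_words (\<Sum>k | of_words (part k) \<noteq> 0. of_words (part k))) w =
        coef (to_words x) w" .
    qed
    then show "x = (\<Sum>k | of_words (part k) \<noteq> 0. of_words (part k))"
      using inj_to_words by (simp add: inj_eq)
  next
    fix g
    assume g: "(\<forall>k. g k \<in> ssym_grade k) \<and> finite {k. g k \<noteq> 0} \<and> x = (\<Sum>k | g k \<noteq> 0. g k)"
    then have off: "coef (to_words (g k)) w = 0" if "length w \<noteq> k" for k w
    proof -
      have "supp (to_words (g k)) \<subseteq> {w. length w = k}"
        using g mem_ssym_grade_iff by blast
      then show ?thesis using that by (auto simp: in_keys_iff)
    qed
    \<comment> \<open>Uniqueness: at a word \<open>w\<close> only the component of degree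
      \<open>length w\<close> contributes, so \<open>x\<close> determines every
      \<open>to_words (g k)\<close>.\<close>
    have x: "coef (to_words x) w = coef (to_words (g (length w))) w" for w
    proof -
      have "to_words x = (\<Sum>k | g k \<noteq> 0. to_words (g k))"
        using g to_words.sum by metis
      then have "coef (to_words x) w = (\<Sum>k | g k \<noteq> 0. coef (to_words (g k)) w)"
        by (simp add: lookup_sum)
      also have "\<dots> = (\<Sum>k | g k \<noteq> 0. if k = length w then coef (to_words (g (length w))) w else 0)"
        using off by (intro sum.cong) auto
      also have "\<dots> = coef (to_words (g (length w))) w"
        using g by (auto simp: to_words.zero)
      finally show ?thesis .
    qed
    have "to_words (g k) = part k" for k
      by (rule poly_mapping_eqI) (auto simp: lookup_part x off)
    then show "g = (\<lambda>k. of_words (part k))"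
      using of_words_to_words by metis
  qed
qed

text \<open>Deconcatenation splits a word of length \<open>k\<close> into words whose lengths add up
  to \<open>k\<close>, and \<open>of_words\<close> takes a word over \<open>indecomposables\<close>
  to the grade given by its length.\<close>

lemma ssym_coproduct_grade:
  assumes "x \<in> ssym_grade k"
  shows "ssym_coproduct x \<in>
    fvs.span (\<Union>(i, j)\<in>{(i, j). i + j = k}. tensor_set (ssym_grade i) (ssym_grade j))"
proof -
  let ?P = "{(w, w'). w \<in> lists indecomposables \<and> w' \<in> lists indecomposables \<and>
    length w + length w' = k}"
  let ?T = "tensor_map of_words of_words"
  interpret T: Vector_Spaces.linear scl scl ?T
    by (rule linear_tensor_map)
  have *: "w @ w' \<in> lists indecomposables \<and> length (w @ w') = k"
    if "coef (to_words x) (w @ w') \<noteq> 0" for w w'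
    using that assms supp_to_words[of x] unfolding mem_ssym_grade_iff
    by (meson in_keys_iff mem_Collect_eq subsetD)
  have "deconcatenation (to_words x) \<in> fvs.span (basis ` ?P)"
    unfolding span_basis
  proof (rule CollectI, rule subsetI)
    fix p assume p: "p \<in> supp (deconcatenation (to_words x))"
    obtain w w' where "p = (w, w')" by (cases p)
    with p *[of w w'] show "p \<in> ?P"
      by (simp add: in_keys_iff lookup_deconcatenation)
  qed
  then have "ssym_coproduct x \<in> fvs.span (?T ` basis ` ?P)"
    unfolding ssym_coproduct_eq T.span_image by (rule imageI)
  moreover have "?T ` basis ` ?P \<subseteq>
    (\<Union>(i, j)\<in>{(i, j). i + j = k}. tensor_set (ssym_grade i) (ssym_grade j))"
    unfolding image_image
  proof (rule image_subsetI)
    fix p assume "p \<in> ?P"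
    then obtain w w' where p: "p = (w, w')" "length w + length w' = k"
      and w: "w \<in> lists indecomposables" "w' \<in> lists indecomposables"
      by blast
    have M: "\<M> (over_list v) \<in> ssym_grade (length v)" if "v \<in> lists indecomposables" for v
      unfolding ssym_grade_def using over_list_in_grade[OF that] by (intro fvs.span_base imageI)
    have "?T (basis (w, w')) \<in> tensor_set (ssym_grade (length w)) (ssym_grade (length w'))"
      unfolding tensor_map_basis of_words_basis tensor_set_def
      using M w by (intro fvs.span_base) blast
    then show "?T (basis p) \<in>
        (\<Union>(i, j)\<in>{(i, j). i + j = k}. tensor_set (ssym_grade i) (ssym_grade j))"
      using p by blast
  qed
  ultimately show ?thesis using fvs.span_mono by blast
qed

lemma ssym_coalgebra_grading: "coalgebra_grading ssym_coproduct ssym_counit ssym_grade"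
  unfolding coalgebra_grading_def
proof (intro conjI allI impI ssym_direct_sum image_subsetI)
  show "ssym_coproduct x \<in>
      fvs.span (\<Union>(i, j)\<in>{(i, j). i + j = k}. tensor_set (ssym_grade i) (ssym_grade j))"
    if "x \<in> ssym_grade k" for x k
    by (rule ssym_coproduct_grade[OF that])
  \<comment> \<open>The counit reads the coefficient at the empty word, whose length is 0.\<close>
  show "ssym_counit x \<in> {0}" if "k \<noteq> 0" "x \<in> ssym_grade k" for x k
    using that by (auto simp: mem_ssym_grade_iff in_keys_iff Q_counit_def simp flip: Q_counit_to_words)
qed

theorem theorem3p1:
  shows "coalgebra_grading ssym_coproduct ssym_counit ssym_grade \<and>
         cofree_graded_coalgebra ssym_coproduct ssym_counit ssym_grade"
proof -
  \<comment> \<open>With this \<open>V\<close> the words over \<open>indecomposables\<close> form a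
    basis of \<open>Q(V)\<close>, and \<open>to_words\<close> sends \<open>\<M> u\<close> for
    indecomposable \<open>u\<close> to the word \<open>[u]\<close>.\<close>
  let ?V = "fvs.span (basis ` indecomposables)"
  have Q: "Q_carrier ?V = {y. supp y \<subseteq> lists indecomposables}"
    unfolding Q_carrier_span_basis by (rule span_basis)
  \<comment> \<open>Preimages are supplied by \<open>of_words\<close>.\<close>
  have "bij_betw to_words UNIV (Q_carrier ?V)"
    unfolding bij_betw_def Q
    using inj_to_words supp_to_words to_words_of_words by (auto simp: image_iff) metis
  moreover have "to_words ` ssym_grade k = tensor_power ?V k" for k
    by (simp only: to_words_image_grade tensor_power_span_basis)
  ultimately show ?thesis
    unfolding cofree_graded_coalgebra_def
    using ssym_coalgebra_grading fvs.subspace_span to_words.linear_axioms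
      deconcatenation_to_words Q_counit_to_words by blast
qed

end
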